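(* Let $L$ be a simple Lie algebra over a field $K$ of characteristic different from $2$ and $3$ (not necessarily finite-dimensional). Then $L$ possesses a nonzero commutative $2$-cocycle if and only if $L$ satisfies the standard identity of degree $5$, i.e. $$\sum_{\sigma\in S_4}\operatorname{sgn}(\sigma)\,[[[[y,x_{\sigma(1)}],x_{\sigma(2)}],x_{\sigma(3)}],x_{\sigma(4)}]=0$$ for all $x_1,x_2,x_3,x_4,y\in L$.
   Context: A commutative $2$-cocycle on a Lie algebra $L$ over $K$ is a symmetric bilinear form $\varphi:L\times L\to K$ such that $\varphi([x,y],z)+\varphi([z,x],y)+\varphi([y,z],x)=0$ for all $x,y,z\in L$. $S_4$ is the symmetric group on $\{1,2,3,4\}$. *)

theory Defs
  imports Complex_Main "HOL-Combinatorics.Permutations"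
begin

definition lie_algebra :: "('k::field \<Rightarrow> 'v::ab_group_add \<Rightarrow> 'v) \<Rightarrow> ('v \<Rightarrow> 'v \<Rightarrow> 'v) \<Rightarrow> bool" where
  "lie_algebra scale br \<longleftrightarrow>
     vector_space scale \<and>
     (\<forall>x. Vector_Spaces.linear scale scale (br x)) \<and>
     (\<forall>y. Vector_Spaces.linear scale scale (\<lambda>x. br x y)) \<and>
     (\<forall>x. br x x = 0) \<and>
     (\<forall>x y z. br x (br y z) + br y (br z x) + br z (br x y) = 0)"

definition lie_ideal :: "('k::field \<Rightarrow> 'v::ab_group_add \<Rightarrow> 'v) \<Rightarrow> ('v \<Rightarrow> 'v \<Rightarrow> 'v) \<Rightarrow> 'v set \<Rightarrow> bool" where
  "lie_ideal scale br I \<longleftrightarrow> module.subspace scale I \<and> (\<forall>x y. y \<in> I \<longrightarrow> br x y \<in> I)"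

definition simple_lie_algebra :: "('k::field \<Rightarrow> 'v::ab_group_add \<Rightarrow> 'v) \<Rightarrow> ('v \<Rightarrow> 'v \<Rightarrow> 'v) \<Rightarrow> bool" where
  "simple_lie_algebra scale br \<longleftrightarrow>
     lie_algebra scale br \<and> (\<exists>x y. br x y \<noteq> 0) \<and>
     (\<forall>I. lie_ideal scale br I \<longrightarrow> I = {0} \<or> I = UNIV)"

definition comm_2_cocycle :: "('k::field \<Rightarrow> 'v::ab_group_add \<Rightarrow> 'v) \<Rightarrow> ('v \<Rightarrow> 'v \<Rightarrow> 'v) \<Rightarrow> ('v \<Rightarrow> 'v \<Rightarrow> 'k) \<Rightarrow> bool" where
  "comm_2_cocycle scale br \<phi> \<longleftrightarrow>
     (\<forall>x. Vector_Spaces.linear scale (*) (\<phi> x)) \<and>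
     (\<forall>y. Vector_Spaces.linear scale (*) (\<lambda>x. \<phi> x y)) \<and>
     (\<forall>x y. \<phi> x y = \<phi> y x) \<and>
     (\<forall>x y z. \<phi> (br x y) z + \<phi> (br z x) y + \<phi> (br y z) x = 0)"

definition satisfies_s5 :: "('k::field \<Rightarrow> 'v::ab_group_add \<Rightarrow> 'v) \<Rightarrow> ('v \<Rightarrow> 'v \<Rightarrow> 'v) \<Rightarrow> bool" where
  "satisfies_s5 scale br \<longleftrightarrow>
     (\<forall>(x::nat \<Rightarrow> 'v) y.
        (\<Sum>\<sigma> | \<sigma> permutes {1..4::nat}.
            scale (of_int (sign \<sigma>))
              (br (br (br (br y (x (\<sigma> 1))) (x (\<sigma> 2))) (x (\<sigma> 3))) (x (\<sigma> 4)))) = 0)"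

end

theory Submission
  imports Defs
begin

text \<open>
  A commutative 2-cocycle \<open>\<phi>\<close> is the same as a map \<open>f : L \<rightarrow> L*\<close> with
  \<open>f [x,y] = - (x f(y) - y f(x))\<close>. Applying \<open>f\<close> to the Jacobi identity gives
  \<open>[x,y] f(z) + [y,z] f(x) + [z,x] f(y) = 0\<close> (characteristic not 2), and the consequences of this
  relation in degree 5 force the standard polynomial of degree 4 to annihilate \<open>f(L)\<close>
  (characteristic not 3). Hence all values of the standard polynomial of degree 5 lie in the
  kernel of \<open>\<phi>\<close>; they span an ideal, so for simple \<open>L\<close> and nonzero \<open>\<phi>\<close> they vanish.

  Conversely, let \<open>C = C(a,b,c)\<close> be the skew-symmetrization of \<open>x \<mapsto> [[[x,a],b],c]\<close>. The standard
  identity gives \<open>[t, C x] + [C t, x] = 2 C [t,x]\<close>, which makes \<open>(t, x) \<mapsto> [t, C x] - C [t,x]\<close> an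
  \<open>L\<close>-valued commutative cocycle. If it vanishes for all \<open>a, b, c\<close>, then every \<open>C\<close> lies in the
  centroid, some \<open>C(z1,z2,z3)\<close> is nonzero because \<open>L\<close> is not metabelian, and the exchange identity
  \<open>C(z1,z2,z3) x = C(x,z2,z3) z1 + C(x,z3,z1) z2 + C(x,z1,z2) z3\<close> shows that \<open>L\<close> has dimension 3
  over its centroid. There the cocycle condition is a single linear equation on the
  six-dimensional space of symmetric forms, so it has a nonzero solution.
\<close>

section \<open>Elementary identities of a Lie bracket\<close>

locale lie_bracket = vector_space scale
  for scale :: "'k::field \<Rightarrow> 'v::ab_group_add \<Rightarrow> 'v" +
  fixes br :: "'v \<Rightarrow> 'v \<Rightarrow> 'v"
  assumes linear_br_right: "Vector_Spaces.linear scale scale (br x)"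
    and linear_br_left: "Vector_Spaces.linear scale scale (\<lambda>x. br x y)"
    and br_self [simp]: "br x x = 0"
    and jacobi: "br x (br y z) + br y (br z x) + br z (br x y) = 0"
begin

lemma br_add_right [simp]: "br x (y + z) = br x y + br x z"
  using linear_br_right[of x] by (simp add: Vector_Spaces.linear_iff)

lemma br_add_left [simp]: "br (x + y) z = br x z + br y z"
  using linear_br_left[of z] by (simp add: Vector_Spaces.linear_iff)

lemma br_scale_right [simp]: "br x (scale r y) = scale r (br x y)"
  using linear_br_right[of x] by (simp add: Vector_Spaces.linear_iff)

lemma br_scale_left [simp]: "br (scale r x) y = scale r (br x y)"
  using linear_br_left[of y] by (simp add: Vector_Spaces.linear_iff)

lemma br_zero_right [simp]: "br x 0 = 0"
  using br_add_right[of x 0 0] by simp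

lemma br_zero_left [simp]: "br 0 x = 0"
  using br_add_left[of 0 0 x] by simp

lemma br_minus_right [simp]: "br x (- y) = - br x y"
  using br_add_right[of x y "- y"] by (simp add: eq_neg_iff_add_eq_0 add.commute)

lemma br_minus_left [simp]: "br (- x) y = - br x y"
  using br_add_left[of x "- x" y] by (simp add: eq_neg_iff_add_eq_0 add.commute)

lemma br_diff_right [simp]: "br x (y - z) = br x y - br x z"
  using br_add_right[of x y "- z"] by simp

lemma br_diff_left [simp]: "br (x - y) z = br x z - br y z"
  using br_add_left[of x "- y" z] by simp

lemma br_anti: "br x y = - br y x"
  using br_self[of "x + y"] by (simp del: br_self add: br_self[of x] br_self[of y] eq_neg_iff_add_eq_0 add.commute)

text \<open>The Jacobi identity oriented as a rewrite rule towards left-normed words.\<close>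

lemma br_br_right: "br x (br y z) = br (br x y) z - br (br x z) y"
proof -
  have "br y (br z x) = br (br x z) y"
    using br_anti[of y "br z x"] br_anti[of z x] by simp
  moreover have "br z (br x y) = - br (br x y) z"
    by (rule br_anti)
  ultimately show ?thesis
    using jacobi[of x y z] by (simp add: algebra_simps)
qed

section \<open>The standard polynomial and the operators \<open>wr\<close>\<close>

text \<open>Antisymmetrizing \<open>br (br y a) b\<close> in \<open>a\<close>, \<open>b\<close>
  gives \<open>br y (br a b)\<close>, so the 24 signed terms of the standard polynomial group into
  these six.\<close>

definition s5 :: "'v \<Rightarrow> 'v \<Rightarrow> 'v \<Rightarrow> 'v \<Rightarrow> 'v \<Rightarrow> 'v" where
  "s5 y a b c d =
     br (br y (br a b)) (br c d) + br (br y (br c d)) (br a b)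
   - br (br y (br a c)) (br b d) - br (br y (br b d)) (br a c)
   + br (br y (br a d)) (br b c) + br (br y (br b c)) (br a d)"

text \<open>
  In the Lie algebra with bracket \<open>[a,b] = a b' - b a'\<close> on functions, \<open>wr a b c x\<close> is, up to sign,
  the product of \<open>x\<close> with the Wronskian of \<open>a, b, c\<close>.
\<close>

definition wr :: "'v \<Rightarrow> 'v \<Rightarrow> 'v \<Rightarrow> 'v \<Rightarrow> 'v" where
  "wr a b c x = br (br x a) (br b c) + br (br x b) (br c a) + br (br x c) (br a b)"

lemma s5_diff:
  "s5 t a b c x - s5 x a b c t
     = br t (wr a b c x) + br (wr a b c t) x - wr a b c (br t x) - wr a b c (br t x)"
proof -
  \<comment> \<open>With \<open>t\<close> moved to the front, all terms become left-normed words
    starting with \<open>t\<close>. These are independent in the free Lie algebra, so comparing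
    coefficients suffices.\<close>
  have flip: "br x t = - br t x" "br a t = - br t a" "br b t = - br t b" "br c t = - br t c"
     "br (br u v) t = - br t (br u v)" for u v
    by (rule br_anti)+
  show ?thesis
    unfolding s5_def wr_def by (simp add: flip br_br_right algebra_simps)
qed

text \<open>Up to sign, four letters admit only three products of two brackets; each term on the
  right is \<open>wr a b c x\<close> with the sign of one of its three summands reversed.\<close>

lemma wr_exchange: "wr a b c x = wr x b c a + wr a x c b + wr a b x c"
  unfolding wr_def
  using br_anti[of "br a x" "br b c"] br_anti[of "br b x" "br c a"] br_anti[of "br c x" "br a b"]
    br_anti[of x a] br_anti[of x b] br_anti[of x c] br_anti[of a b] br_anti[of b c] br_anti[of c a]
  by simp

text \<open>Recovers products of brackets from \<open>wr\<close>: outside characteristic 2, an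
  algebra in which every \<open>wr\<close> vanishes is metabelian.\<close>

lemma br_br_eq_wr:
  "br (br a b) (br c x) + br (br a b) (br c x) = wr b c x a - wr c x a b"
  unfolding wr_def
  using br_anti[of "br a x" "br b c"] br_anti[of "br a c" "br b x"] br_anti[of "br c x" "br a b"]
    br_anti[of x a] br_anti[of x b] br_anti[of x c] br_anti[of b a] br_anti[of c b] br_anti[of c a]
  by simp

text \<open>\<open>br x\<close> is a derivation, so it acts on one argument of \<open>s5\<close> at
  a time. This makes the span of the values of \<open>s5\<close> an ideal.\<close>

lemma br_s5:
  "br x (s5 y a b c d)
     = s5 (br x y) a b c d + s5 y (br x a) b c d + s5 y a (br x b) c d
     + s5 y a b (br x c) d + s5 y a b c (br x d)"
proof -
  have der: "br x (br u v) = br (br x u) v + br u (br x v)" for u v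
    using br_br_right[of x u v] br_anti[of u "br x v"] by simp
  show ?thesis
    unfolding s5_def by (simp add: der algebra_simps)
qed

lemma s5_eq_sum_permutations:
  "(\<Sum>\<sigma> | \<sigma> permutes {1..4::nat}. scale (of_int (sign \<sigma>))
      (br (br (br (br y (x (\<sigma> 1))) (x (\<sigma> 2))) (x (\<sigma> 3))) (x (\<sigma> 4))))
   = s5 y (x 1) (x 2) (x 3) (x 4)"
proof -
  have set_eq: "{1..4::nat} = {1, 2, 3, 4}"
    by auto
  have ins: "finite {2::nat, 3, 4}" "1 \<notin> {2::nat, 3, 4}" "finite {3::nat, 4}" "2 \<notin> {3::nat, 4}"
    "finite {4::nat}" "3 \<notin> {4::nat}"
    by auto
  show ?thesis
    unfolding set_eq sum_over_permutations_insert[OF ins(1,2)]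
      sum_over_permutations_insert[OF ins(3,4)] sum_over_permutations_insert[OF ins(5,6)]
      permutes_sing s5_def
    by (simp add: sign_swap_id permutation_swap_id permutation_compose sign_compose sign_id
        Transposition.transpose_def br_br_right algebra_simps)
qed

section \<open>Commutative cocycles annihilate the standard polynomial\<close>

definition alt4 :: "('v \<Rightarrow> 'v \<Rightarrow> 'v \<Rightarrow> 'v \<Rightarrow> 'k) \<Rightarrow> 'v \<Rightarrow> 'v \<Rightarrow> 'v \<Rightarrow> 'v \<Rightarrow> 'k" where
  "alt4 g a b c d =
     g a b c d - g a b d c - g a c b d + g a c d b + g a d b c - g a d c b
      - g b a c d + g b a d c + g b c a d - g b c d a - g b d a c + g b d c a
      + g c a b d - g c a d b - g c b a d + g c b d a + g c d a b - g c d b a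
      - g d a b c + g d a c b + g d b a c - g d b c a - g d c a b + g d c b a"

context
  fixes \<phi> :: "'v \<Rightarrow> 'v \<Rightarrow> 'k"
  assumes cocycle: "comm_2_cocycle scale br \<phi>"
begin

lemma cocycle_linear_right: "Vector_Spaces.linear scale (*) (\<phi> x)"
  using cocycle by (simp add: comm_2_cocycle_def)

lemma cocycle_add_right: "\<phi> x (y + z) = \<phi> x y + \<phi> x z"
  using cocycle_linear_right[of x] by (simp add: Vector_Spaces.linear_iff)

lemma cocycle_zero_right: "\<phi> x 0 = 0"
  by (metis add_cancel_left_left add.right_neutral cocycle_add_right)

lemma cocycle_minus_right: "\<phi> x (- y) = - \<phi> x y"
  using cocycle_add_right[of x y "- y"]
  by (simp add: eq_neg_iff_add_eq_0 add.commute cocycle_zero_right)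

lemma cocycle_diff_right: "\<phi> x (y - z) = \<phi> x y - \<phi> x z"
  using cocycle_add_right[of x y "- z"] by (simp add: cocycle_minus_right)

lemma cocycle_sym: "\<phi> x y = \<phi> y x"
  using cocycle by (simp add: comm_2_cocycle_def)

text \<open>Empties the first argument of brackets. Together with \<open>br_br_right\<close> it
  reduces every value to ones with a single letter on the left and a left-normed word on the
  right.\<close>

lemma cocycle_br_left: "\<phi> (br x y) u = \<phi> x (br u y) - \<phi> y (br u x)"
proof -
  have "\<phi> (br x y) u + \<phi> (br u x) y + \<phi> (br y u) x = 0"
    using cocycle unfolding comm_2_cocycle_def by blast
  moreover have "\<phi> (br u x) y = \<phi> y (br u x)" "\<phi> (br y u) x = - \<phi> x (br u y)"
    using cocycle_sym[of x "br y u"] cocycle_sym[of y "br u x"] br_anti[of y u]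
    by (simp_all add: cocycle_minus_right)
  ultimately show ?thesis
    by (simp add: algebra_simps)
qed

lemmas cocycle_expand = br_br_right cocycle_add_right cocycle_diff_right cocycle_minus_right cocycle_br_left

lemma cocycle_cyclic:
  assumes two: "(2::'k) \<noteq> 0"
  shows "\<phi> t (br z (br x y)) + \<phi> x (br z (br y t)) + \<phi> y (br z (br t x)) = 0" (is "?S = 0")
proof -
  have "br (br x y) t + br (br y t) x + br (br t x) y = 0"
    using br_br_right[of t x y] br_anti[of t "br x y"] br_anti[of t x] br_anti[of y t]
    by (simp add: algebra_simps)
  then have "\<phi> z (br (br x y) t + br (br y t) x + br (br t x) y) = \<phi> z 0"
    by simp
  then have "\<phi> z (br (br x y) t) + \<phi> z (br (br y t) x) + \<phi> z (br (br t x) y) = 0"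
    by (simp add: cocycle_add_right cocycle_zero_right)
  then have "\<phi> (br (br x y) t) z + \<phi> (br (br y t) x) z + \<phi> (br (br t x) y) z = 0"
    using cocycle_sym by metis
  \<comment> \<open>The outer brackets contribute one copy of \<open>?S\<close>; the inner ones,
    after antisymmetric pairs recombine into brackets, contribute another.\<close>
  then have "2 * ?S = 0"
    by (simp add: cocycle_expand algebra_simps)
  then show ?thesis
    using two by (metis mult_eq_0_iff)
qed

lemma cocycle_s5:
  assumes two: "(2::'k) \<noteq> 0" and three: "(3::'k) \<noteq> 0"
  shows "\<phi> w (s5 z a b c d) = 0"
proof -
  define rel where "rel x y t z = \<phi> t (br z (br x y)) + \<phi> x (br z (br y t)) + \<phi> y (br z (br t x))"
    for x y t z
  have rel_0: "rel x y t z = 0" for x y t z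
    unfolding rel_def using cocycle_cyclic[OF two] by blast
  txt \<open>Skew-symmetrizing over \<open>a, b, c, d\<close> leaves only four words ending in \<open>f(d)\<close>, told apart
    by the position of \<open>w\<close>; each equation below skew-symmetrizes one consequence of \<open>rel\<close>.\<close>
  define W1 where "W1 = alt4 (\<lambda>a b c d. \<phi> d (br (br (br (br z w) a) b) c)) a b c d"
  define W2 where "W2 = alt4 (\<lambda>a b c d. \<phi> d (br (br (br (br z a) w) b) c)) a b c d"
  define W3 where "W3 = alt4 (\<lambda>a b c d. \<phi> d (br (br (br (br z a) b) w) c)) a b c d"
  define W4 where "W4 = alt4 (\<lambda>a b c d. \<phi> d (br (br (br (br z a) b) c) w)) a b c d"
  note W_defs = W1_def W2_def W3_def W4_def alt4_def
  have "W4 - 2 * W3 - W2 + 2 * W1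
    = rel (br a b) (br c w) d z - rel (br a b) (br d w) c z
      - rel (br a c) (br b w) d z + rel (br a c) (br d w) b z
      + rel (br a d) (br b w) c z - rel (br a d) (br c w) b z
      + rel (br b c) (br a w) d z - rel (br b c) (br d w) a z
      - rel (br b d) (br a w) c z + rel (br b d) (br c w) a z
      + rel (br c d) (br a w) b z - rel (br c d) (br b w) a z"
    unfolding W_defs rel_def by (simp add: cocycle_expand algebra_simps)
  then have 1: "W4 - 2 * W3 - W2 + 2 * W1 = 0"
    by (simp add: rel_0)
  have "\<phi> w (s5 z a b c d) - W4 + W3
    = rel c d w (br z (br a b)) - rel b d w (br z (br a c))
      + rel b c w (br z (br a d)) + rel a d w (br z (br b c))
      - rel a c w (br z (br b d)) + rel a b w (br z (br c d))"
    unfolding W_defs rel_def s5_def by (simp add: cocycle_expand algebra_simps)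
  then have 2: "\<phi> w (s5 z a b c d) - W4 + W3 = 0"
    by (simp add: rel_0)
  have "W4 + W3 - 2 * W2
    = rel a w (br b c) (br z d) - rel a w (br b d) (br z c)
      + rel a w (br c d) (br z b) - rel b w (br a c) (br z d)
      + rel b w (br a d) (br z c) - rel b w (br c d) (br z a)
      + rel c w (br a b) (br z d) - rel c w (br a d) (br z b)
      + rel c w (br b d) (br z a) - rel d w (br a b) (br z c)
      + rel d w (br a c) (br z b) - rel d w (br b c) (br z a)"
    unfolding W_defs rel_def by (simp add: cocycle_expand algebra_simps)
  then have 3: "W4 + W3 - 2 * W2 = 0"
    by (simp add: rel_0)
  have "W2 - W1
    = rel b c d (br z (br a w)) - rel a c d (br z (br b w))
      + rel a b d (br z (br c w)) - rel a b c (br z (br d w))"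
    unfolding W_defs rel_def by (simp add: cocycle_expand algebra_simps)
  then have 4: "W2 = W1"
    by (simp add: rel_0)
  \<comment> \<open>Since \<open>W2 = W1\<close>, the first relation reads
    \<open>W4 - 2 * W3 + W2 = 0\<close>; subtracting it from the third leaves a multiple of
    3.\<close>
  have "3 * (W3 - W2) = (W4 + W3 - 2 * W2) - (W4 - 2 * W3 - W2 + 2 * W1)"
    by (simp add: 4 algebra_simps)
  then have "W3 = W2"
    using 1 3 three by simp
  with 3 have "W4 = W3"
    by simp
  with 2 show ?thesis
    by simp
qed

end

section \<open>Multilinearity of \<open>wr\<close> and the centroid\<close>

lemma wr_add [simp]: "wr a b c (x + y) = wr a b c x + wr a b c y"
  by (simp add: wr_def algebra_simps)

lemma wr_scale [simp]: "wr a b c (scale r x) = scale r (wr a b c x)"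
  by (simp add: wr_def scale_right_distrib)

lemma wr_add_1 [simp]: "wr (a + a') b c x = wr a b c x + wr a' b c x"
  by (simp add: wr_def algebra_simps)

lemma wr_scale_1 [simp]: "wr (scale r a) b c x = scale r (wr a b c x)"
  by (simp add: wr_def scale_right_distrib)

lemma wr_cycle: "wr a b c x = wr b c a x"
  by (simp add: wr_def algebra_simps)

lemma wr_repeat [simp]: "wr a a c x = 0" "wr a b a x = 0" "wr a b b x = 0"
  unfolding wr_def using br_anti[of a c] br_anti[of a b] by simp_all

lemma br_wr_symmetric_part:
  assumes "\<And>y a b c d. s5 y a b c d = 0"
  shows "br t (wr a b c x) + br (wr a b c t) x = wr a b c (br t x) + wr a b c (br t x)"
  using s5_diff[of t a b c x] assms by (simp add: algebra_simps)

definition centroidal :: "('v \<Rightarrow> 'v) \<Rightarrow> bool" where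
  "centroidal f \<longleftrightarrow> Vector_Spaces.linear scale scale f \<and> (\<forall>x y. f (br x y) = br x (f y))"

lemma centroidal_add: "centroidal f \<Longrightarrow> f (x + y) = f x + f y"
  by (simp add: centroidal_def Vector_Spaces.linear_iff)

lemma centroidal_scale: "centroidal f \<Longrightarrow> f (scale r x) = scale r (f x)"
  by (simp add: centroidal_def Vector_Spaces.linear_iff)

lemma centroidal_zero: "centroidal f \<Longrightarrow> f 0 = 0"
  using centroidal_add[of f 0 0] by simp

lemma centroidal_minus: "centroidal f \<Longrightarrow> f (- x) = - f x"
  using centroidal_add[of f x "- x"] by (simp add: centroidal_zero eq_neg_iff_add_eq_0 add.commute)

lemma centroidal_br_right: "centroidal f \<Longrightarrow> f (br x y) = br x (f y)"
  by (simp add: centroidal_def)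

lemma centroidal_br_left: "centroidal f \<Longrightarrow> f (br x y) = br (f x) y"
  using br_anti[of x y] br_anti[of "f x" y] by (simp add: centroidal_minus centroidal_br_right)

lemma centroidal_wr_1:
  assumes f: "centroidal f"
  shows "wr (f a) b c x = f (wr a b c x)"
  \<comment> \<open>Each instance pushes \<open>f\<close> inward, towards the single occurrence of
    \<open>a\<close> in a summand.\<close>
  by (simp only: wr_def centroidal_add[OF f] centroidal_br_left[OF f, of "br x a"]
      centroidal_br_right[OF f, of "br x b"] centroidal_br_right[OF f, of "br x c"]
      centroidal_br_right[OF f, of x a] centroidal_br_right[OF f, of c a] centroidal_br_left[OF f, of a b])

lemma double_eq_0:
  fixes x :: 'v
  assumes "(2::'k) \<noteq> 0" and "x + x = 0"
  shows "x = 0"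
proof -
  have "scale 2 x = 0"
    using assms(2) scale_left_distrib[of 1 1 x] by simp
  then show ?thesis
    using assms(1) by simp
qed

section \<open>Scalar cocycles from vector-valued ones\<close>

text \<open>Compose with a linear functional that takes the value 1 at
  \<open>\<Phi> u v\<close>.\<close>

lemma cocycle_from_vector_valued:
  fixes \<Phi> :: "'v \<Rightarrow> 'v \<Rightarrow> 'v"
  assumes add: "\<And>x y z. \<Phi> (x + y) z = \<Phi> x z + \<Phi> y z"
    and sc: "\<And>r x z. \<Phi> (scale r x) z = scale r (\<Phi> x z)"
    and sym: "\<And>x y. \<Phi> x y = \<Phi> y x"
    and coc: "\<And>x y z. \<Phi> (br x y) z + \<Phi> (br z x) y + \<Phi> (br y z) x = 0"
    and nz: "\<Phi> u v \<noteq> 0"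
  shows "\<exists>\<phi>. comm_2_cocycle scale br \<phi> \<and> (\<exists>x y. \<phi> x y \<noteq> 0)"
proof -
  interpret field: vector_space "(*) :: 'k \<Rightarrow> 'k \<Rightarrow> 'k"
    by unfold_locales (auto simp: algebra_simps)
  interpret vector_space_pair scale "(*) :: 'k \<Rightarrow> 'k \<Rightarrow> 'k" ..
  obtain g where g: "Vector_Spaces.linear scale (*) g" and gu: "g (\<Phi> u v) = 1"
    using linear_independent_extend[of "{\<Phi> u v}" "\<lambda>_. 1"] nz by auto
  have g_add: "g (x + y) = g x + g y" and g_scale: "g (scale r x) = r * g x" for x y r
    using g by (simp_all add: Vector_Spaces.linear_iff)
  have g_0: "g 0 = 0"
    using g_scale[of 0 0] by simp
  define \<phi> where "\<phi> x y = g (\<Phi> x y)" for x y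
  have sym': "\<phi> x y = \<phi> y x" for x y
    by (simp add: \<phi>_def sym[of x y])
  have lin: "Vector_Spaces.linear scale (*) (\<lambda>x. \<phi> x y)" for y
    unfolding \<phi>_def Vector_Spaces.linear_iff
    by (simp add: add sc g_add g_scale vector_space_axioms field.vector_space_axioms)
  have lin': "Vector_Spaces.linear scale (*) (\<phi> y)" for y
    using lin[of y] by (simp add: sym'[of y, abs_def])
  have "\<phi> (br x y) z + \<phi> (br z x) y + \<phi> (br y z) x = 0" for x y z
    unfolding \<phi>_def g_add[symmetric] coc by (rule g_0)
  then have "comm_2_cocycle scale br \<phi>"
    unfolding comm_2_cocycle_def using lin lin' sym' by blast
  moreover have "\<phi> u v \<noteq> 0"
    by (simp add: \<phi>_def gu)
  ultimately show ?thesis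
    by blast
qed

lemma cocycle_if_wr_not_centroidal:
  assumes s5: "\<And>y a b c d. s5 y a b c d = 0"
    and neq: "wr a b c (br u v) \<noteq> br u (wr a b c v)"
  shows "\<exists>\<phi>. comm_2_cocycle scale br \<phi> \<and> (\<exists>x y. \<phi> x y \<noteq> 0)"
proof -
  define C where "C = wr a b c"
  define \<Phi> where "\<Phi> t x = br t (C x) - C (br t x)" for t x
  have C_add: "C (x + y) = C x + C y" and C_scale: "C (scale r x) = scale r (C x)" for x y r
    by (simp_all add: C_def)
  have C_0: "C 0 = 0"
    using C_add[of 0 0] by simp
  have C_minus: "C (- x) = - C x" for x
    using C_add[of x "- x"] by (simp add: C_0 eq_neg_iff_add_eq_0 add.commute)
  have C_br: "br t (C x) - br x (C t) = C (br t x) + C (br t x)" for t x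
    using br_wr_symmetric_part[OF s5, of t a b c x] br_anti[of x "C t"] by (simp add: C_def)
  have sym: "\<Phi> t x = \<Phi> x t" for t x
    using C_br[of t x] br_anti[of x t] by (simp add: \<Phi>_def C_minus algebra_simps)
  have coc: "\<Phi> (br x y) z + \<Phi> (br z x) y + \<Phi> (br y z) x = 0" for x y z
  proof -
    \<comment> \<open>The cyclic sum is computed from either side of the symmetric
      \<open>\<Phi>\<close>. The derivation property and \<open>C_br\<close> turn one result into
      twice the other, so \<open>S = S + S\<close>.\<close>
    define S where "S = \<Phi> (br x y) z + \<Phi> (br z x) y + \<Phi> (br y z) x"
    have jac: "C (br z (br x y)) + C (br y (br z x)) + C (br x (br y z)) = 0"
      using jacobi[of z x y] C_0 by (simp add: C_add[symmetric] add.commute add.left_commute)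
    have S1: "S = br z (C (br x y)) + br y (C (br z x)) + br x (C (br y z))"
      unfolding S_def sym[of "br _ _"] using jac by (simp add: \<Phi>_def algebra_simps)
    have der: "br (br x y) u = br x (br y u) - br y (br x u)" for x y u
      using br_br_right[of u x y] br_anti[of "br x y" u] br_anti[of u x] br_anti[of u y]
        br_anti[of "br y u" x] br_anti[of "br x u" y] by simp
    have "S = br (br x y) (C z) + br (br z x) (C y) + br (br y z) (C x)"
      using jac br_anti[of "br x y" z] br_anti[of "br z x" y] br_anti[of "br y z" x]
      by (simp add: S_def \<Phi>_def C_minus algebra_simps)
    also have "\<dots> = br z (br x (C y) - br y (C x)) + br y (br z (C x) - br x (C z))
        + br x (br y (C z) - br z (C y))"
      by (simp add: der algebra_simps)
    also have "\<dots> = S + S"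
      unfolding C_br S1 by (simp add: algebra_simps)
    finally show ?thesis
      by (simp add: S_def)
  qed
  show ?thesis
  proof (rule cocycle_from_vector_valued)
    show "\<Phi> (x + y) z = \<Phi> x z + \<Phi> y z" for x y z
      by (simp add: \<Phi>_def C_add)
    show "\<Phi> (scale r x) z = scale r (\<Phi> x z)" for r x z
      by (simp add: \<Phi>_def C_scale scale_right_diff_distrib)
    show "\<Phi> u v \<noteq> 0"
      using neq by (simp add: \<Phi>_def C_def)
  qed (fact sym coc)+
qed

end

section \<open>Consequences of simplicity\<close>

locale simple_lie_bracket = lie_bracket scale br
  for scale :: "'k::field \<Rightarrow> 'v::ab_group_add \<Rightarrow> 'v" and br +
  assumes nonabelian: "\<exists>x y. br x y \<noteq> 0"
    and simple: "\<And>I. subspace I \<Longrightarrow> (\<And>x y. y \<in> I \<Longrightarrow> br x y \<in> I) \<Longrightarrow> I = {0} \<or> I = UNIV"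
begin

lemma center_trivial:
  assumes "\<And>y. br y x = 0"
  shows "x = 0"
proof -
  let ?Z = "{x. \<forall>y. br y x = 0}"
  have "?Z = {0} \<or> ?Z = UNIV"
    by (rule simple) (auto simp: subspace_def)
  moreover have "?Z \<noteq> UNIV"
    using nonabelian by auto
  ultimately show ?thesis
    using assms by auto
qed

lemma span_brackets: "span {br x y | x y. True} = UNIV"
proof -
  let ?I = "span {br x y | x y. True}"
  have "br x y \<in> ?I" for x y
    by (rule span_base) blast
  then have "?I = {0} \<or> ?I = UNIV"
    by (intro simple) auto
  moreover have "?I \<noteq> {0}"
    using nonabelian \<open>\<And>x y. br x y \<in> ?I\<close> by blast
  ultimately show ?thesis
    by blast
qed

text \<open>Brackets span the algebra, so otherwise every bracket would be central, hence
  zero.\<close>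

lemma not_metabelian: "\<exists>a b c d. br (br a b) (br c d) \<noteq> 0"
proof (rule ccontr)
  assume "\<not> ?thesis"
  then have zero: "br (br a b) (br c d) = 0" for a b c d
    by blast
  have "br (br a b) y = 0" for a b y
  proof -
    have "y \<in> span {br x y | x y. True}"
      unfolding span_brackets by (rule UNIV_I)
    then show ?thesis
      by (induction rule: span_induct) (auto simp: zero subspace_def)
  qed
  then have "br a b = 0" for a b
    using center_trivial[of "br a b"] br_anti[of _ "br a b"] by simp
  then show False
    using nonabelian by blast
qed

lemma wr_nonzero:
  assumes "(2::'k) \<noteq> 0"
  shows "\<exists>a b c x. wr a b c x \<noteq> 0"
proof (rule ccontr)
  assume "\<not> ?thesis"
  then have "br (br a b) (br c x) + br (br a b) (br c x) = 0" for a b c x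
    by (simp add: br_br_eq_wr)
  then have "br (br a b) (br c x) = 0" for a b c x
    by (rule double_eq_0[OF assms])
  then show False
    using not_metabelian by blast
qed

text \<open>Schur's argument: the kernel of a centroidal map is an ideal.\<close>

lemma centroidal_inj:
  assumes f: "centroidal f" and "f u \<noteq> 0" and "f x = 0"
  shows "x = 0"
proof -
  let ?K = "{x. f x = 0}"
  have "?K = {0} \<or> ?K = UNIV"
    using f by (intro simple)
      (auto simp: subspace_def centroidal_zero centroidal_add centroidal_scale centroidal_br_right)
  then show ?thesis
    using assms(2,3) by auto
qed

text \<open>The two maps can be moved onto different factors of \<open>br y x\<close>, where their
  order is immaterial; the trivial centre then removes \<open>y\<close>.\<close>

lemma centroidal_commute:
  assumes f: "centroidal f" and g: "centroidal g"
  shows "f (g x) = g (f x)"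
proof -
  have "br y (f (g x)) = br y (g (f x))" for y
    by (metis centroidal_br_right[OF f] centroidal_br_left[OF g] centroidal_br_right[OF g])
  then have "br y (f (g x) - g (f x)) = 0" for y
    by simp
  then have "f (g x) - g (f x) = 0"
    by (rule center_trivial)
  then show ?thesis
    by simp
qed

section \<open>The three-dimensional case over the centroid\<close>

lemma cocycle_if_wr_centroidal:
  assumes two: "(2::'k) \<noteq> 0"
    and cent: "\<And>a b c. centroidal (wr a b c)"
  shows "\<exists>\<phi>. comm_2_cocycle scale br \<phi> \<and> (\<exists>x y. \<phi> x y \<noteq> 0)"
proof -
  obtain z1 z2 z3 v where v: "wr z1 z2 z3 v \<noteq> 0"
    using wr_nonzero[OF two] by blast
  define c where "c = wr z1 z2 z3"
  \<comment> \<open>By the exchange identity, \<open>T1 x\<close>, \<open>T2 x\<close>,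
    \<open>T3 x\<close> are \<open>c\<close> times the coordinates of \<open>x\<close> with respect
    to \<open>z1\<close>, \<open>z2\<close>, \<open>z3\<close>. Injectivity of \<open>c\<close>
    replaces division by it.\<close>
  define T1 where "T1 x = wr x z2 z3" for x
  define T2 where "T2 x = wr x z3 z1" for x
  define T3 where "T3 x = wr x z1 z2" for x
  note T_defs = T1_def T2_def T3_def
  have cent_c: "centroidal c" and cent_T: "centroidal (T1 x)" "centroidal (T2 x)" "centroidal (T3 x)" for x
    by (simp_all add: T_defs c_def cent)
  have c_inj: "x = 0" if "c x = 0" for x
    using centroidal_inj[OF cent_c _ that] v by (auto simp: c_def)
  have v0: "v \<noteq> 0"
    using v centroidal_zero[OF cent_c] by (auto simp: c_def)
  have c_expand: "c x = T1 x z1 + T2 x z2 + T3 x z3" for x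
    unfolding c_def T_defs using wr_exchange[of z1 z2 z3 x]
      wr_cycle[of z1 x z3 z2] wr_cycle[of z1 z2 x z3] wr_cycle[of z2 x z1 z3]
    by (metis (no_types))
  have T_add: "T1 (x + y) u = T1 x u + T1 y u" "T2 (x + y) u = T2 x u + T2 y u" for x y u
    by (simp_all add: T_defs)
  have T_scale: "T1 (scale r x) u = scale r (T1 x u)" "T2 (scale r x) u = scale r (T2 x u)" for r x u
    by (simp_all add: T_defs)
  have T_cent: "T1 (f x) u = f (T1 x u)" "T2 (f x) u = f (T2 x u)" if "centroidal f" for f x u
    unfolding T_defs using that by (rule centroidal_wr_1)+
  have T_z: "T1 z1 = c" "T1 z2 u = 0" "T1 z3 u = 0" "T2 z1 u = 0" "T2 z2 = c" "T2 z3 u = 0" for u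
    by (simp_all add: T_defs c_def fun_eq_iff wr_cycle[of z2 z3 z1] wr_cycle[of z3 z1 z2])

  txt \<open>\<open>pq\<close> says that the cocycle defect of \<open>p T1 T1 - q T2 T2\<close> vanishes at \<open>(z1, z2, z3)\<close>, hence
    everywhere: the defect is alternating and trilinear over the centroid.\<close>
  have key: ?thesis
    if p: "centroidal p" and q: "centroidal q"
      and pq: "p (T1 (br z2 z3) (c v)) = q (T2 (br z3 z1) (c v))"
      and nz: "p (T1 u (T1 u v)) \<noteq> q (T2 u (T2 u v))"
    for p q u
  proof -
    define \<Phi> where "\<Phi> x y = p (T1 x (T1 y v)) - q (T2 x (T2 y v))" for x y
    have add: "\<Phi> (x + y) z = \<Phi> x z + \<Phi> y z" for x y z
      by (simp add: \<Phi>_def T_add centroidal_add[OF p] centroidal_add[OF q])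
    have sc: "\<Phi> (scale r x) z = scale r (\<Phi> x z)" for r x z
      by (simp add: \<Phi>_def T_scale centroidal_scale[OF p] centroidal_scale[OF q] scale_right_diff_distrib)
    have sym: "\<Phi> x y = \<Phi> y x" for x y
      unfolding \<Phi>_def
      using centroidal_commute[OF cent_T(1) cent_T(1)] centroidal_commute[OF cent_T(2) cent_T(2)]
      by metis
    have add_right: "\<Phi> x (y + z) = \<Phi> x y + \<Phi> x z" for x y z
      using add[of y z x] by (simp add: sym[of x])
    have \<Phi>_0: "\<Phi> 0 x = 0" for x
      using add[of 0 0 x] by simp
    have minus: "\<Phi> (- x) y = - \<Phi> x y" for x y
      using add[of x "- x" y] by (simp add: \<Phi>_0 eq_neg_iff_add_eq_0 add.commute)
    have \<Phi>_cent: "\<Phi> (f x) y = f (\<Phi> x y)" if f: "centroidal f" for f x y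
    proof -
      have "f (a - b) = f a - f b" for a b
        using centroidal_add[OF f, of a "- b"] by (simp add: centroidal_minus[OF f])
      then show ?thesis
        by (simp add: \<Phi>_def T_cent[OF f] centroidal_commute[OF p f] centroidal_commute[OF q f])
    qed
    have \<Phi>_cent_right: "\<Phi> x (f y) = f (\<Phi> x y)" if f: "centroidal f" for f x y
      using \<Phi>_cent[OF f, of y x] by (simp add: sym[of x])

    define D where "D x y t = \<Phi> (br x y) t + \<Phi> (br t x) y + \<Phi> (br y t) x" for x y t
    have D_cyc: "D x y t = D y t x" for x y t
      by (simp add: D_def algebra_simps)
    have D_same: "D x x t = 0" for x t
      using br_anti[of x t] by (simp add: D_def \<Phi>_0 minus)
    have D_add: "D x y (t + t') = D x y t + D x y t'" for x y t t'
      by (simp add: D_def add add_right algebra_simps)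
    have D_cent: "D x y (f t) = f (D x y t)" if f: "centroidal f" for f x y t
      by (simp add: D_def \<Phi>_cent[OF f] \<Phi>_cent_right[OF f] centroidal_add[OF f]
          centroidal_br_left[OF f, symmetric] centroidal_br_right[OF f, symmetric])
    have D_expand: "D x y t = 0" if "D x y z1 = 0" "D x y z2 = 0" "D x y z3 = 0" for x y t
    proof (rule c_inj)
      have "c (D x y t) = D x y (c t)"
        by (simp add: D_cent[OF cent_c])
      also have "\<dots> = 0"
        unfolding c_expand D_add by (simp add: D_cent cent_T that centroidal_zero)
      finally show "c (D x y t) = 0" .
    qed
    have D_z: "D z1 z2 z3 = 0"
      unfolding D_def \<Phi>_def
      by (simp add: T_z pq centroidal_zero p q cent_T cent_c)
    have D_z': "D z2 z3 z1 = 0" "D z3 z1 z2 = 0"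
      using D_z D_cyc[of z1 z2 z3] D_cyc[of z2 z3 z1] by simp_all
    have D_same': "D x y x = 0" "D x y y = 0" for x y
      using D_same D_cyc by metis+
    have D_add': "D (x + x') y t = D x y t + D x' y t" "D x (y + y') t = D x y t + D x y' t"
      for x x' y y' t
      using D_add D_cyc by metis+
    have D_swap: "D y x t = - D x y t" for x y t
      using D_same[of "x + y" t, unfolded D_add'] by (simp add: D_add' D_same eq_neg_iff_add_eq_0 add.commute)
    \<comment> \<open>Arbitrary vectors replace the \<open>z1\<close>, \<open>z2\<close>,
      \<open>z3\<close> one slot at a time, cyclicity bringing each slot to the last place.\<close>
    have D_zz: "D z1 z2 t = 0" "D z2 z3 t = 0" "D z3 z1 t = 0" for t
      by (rule D_expand; simp add: D_same' D_z D_z')+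
    have D_zz': "D z2 z1 t = 0" "D z3 z2 t = 0" "D z1 z3 t = 0" for t
      using D_swap[of z2 z1 t] D_swap[of z3 z2 t] D_swap[of z1 z3 t] by (simp_all add: D_zz)
    have D_z_mid: "D t z1 y = 0" "D t z2 y = 0" "D t z3 y = 0" for t y
      by (rule D_expand; simp add: D_cyc[of t] D_zz D_zz' D_same')+
    have D_0: "D x y t = 0" for x y t
      by (rule D_expand; simp add: D_cyc[of x] D_z_mid)
    show ?thesis
    proof (rule cocycle_from_vector_valued)
      show "\<Phi> (br x y) z + \<Phi> (br z x) y + \<Phi> (br y z) x = 0" for x y z
        using D_0[of x y z] by (simp add: D_def)
      show "\<Phi> u u \<noteq> 0"
        using nz by (simp add: \<Phi>_def)
    qed (fact add sc sym)+
  qed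

  show ?thesis
  \<comment> \<open>If \<open>T1 (br z2 z3)\<close> vanishes, the form built from \<open>T1\<close>
    alone works, nonzero at \<open>z1\<close>. Otherwise the crosswise choice
    \<open>p = T2 (br z3 z1)\<close>, \<open>q = T1 (br z2 z3)\<close> satisfies \<open>pq\<close>
    because centroidal maps commute, and \<open>z2\<close> sees only the nonzero \<open>q\<close>
    term.\<close>
  proof (cases "\<forall>u. T1 (br z2 z3) u = 0")
    case True
    have "centroidal (\<lambda>x. x)" "centroidal (\<lambda>x. 0)"
      by (auto simp: centroidal_def Vector_Spaces.linear_iff vector_space_axioms)
    moreover have "c (c v) \<noteq> 0"
      using v0 c_inj by blast
    ultimately show ?thesis
      using key[of "\<lambda>x. x" "\<lambda>x. 0" z1] True by (simp add: T_z)
  next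
    case False
    then have "x = 0" if "T1 (br z2 z3) x = 0" for x
      using centroidal_inj[OF cent_T(1) _ that] by blast
    then have "T1 (br z2 z3) (c (c v)) \<noteq> 0"
      using v0 c_inj by blast
    then show ?thesis
      using key[OF cent_T(2) cent_T(1), of "br z3 z1" "br z2 z3" z2]
      by (simp add: T_z centroidal_zero cent_T centroidal_commute[OF cent_T(2) cent_T(1)])
  qed
qed

section \<open>From a nonzero cocycle to the standard identity, and the equivalence\<close>

lemma s5_if_cocycle:
  assumes "(2::'k) \<noteq> 0" "(3::'k) \<noteq> 0"
    and \<phi>: "comm_2_cocycle scale br \<phi>" and nz: "\<phi> u v \<noteq> 0"
  shows "s5 y a b c d = 0"
proof (rule ccontr)
  let ?I = "span {s5 y a b c d | y a b c d. True}"
  have s5_in: "s5 y a b c d \<in> ?I" for y a b c d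
    by (rule span_base) blast
  assume "s5 y a b c d \<noteq> 0"
  with s5_in have "?I \<noteq> {0}"
    by blast
  moreover have "br x w \<in> ?I" if "w \<in> ?I" for x w
    using that
  proof (induction rule: span_induct)
    case base
    show ?case
      by (auto simp: subspace_def span_zero span_add span_scale)
  next
    case (step w)
    then obtain y a b c d where "w = s5 y a b c d"
      by blast
    then show ?case
      by (simp only: br_s5) (intro span_add s5_in)
  qed
  then have "?I = {0} \<or> ?I = UNIV"
    by (intro simple) auto
  ultimately have "v \<in> ?I"
    by blast
  then have "\<phi> u v = 0"
  proof (induction rule: span_induct)
    case base
    show ?case
      using cocycle_linear_right[OF \<phi>, of u]
      by (auto simp: subspace_def Vector_Spaces.linear_iff cocycle_zero_right[OF \<phi>])
  next
    case (step w)
    then show ?case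
      using cocycle_s5[OF \<phi> assms(1,2)] by blast
  qed
  with nz show False
    by contradiction
qed

end

theorem theorem2p3:
  fixes scale :: "'k::field \<Rightarrow> 'v::ab_group_add \<Rightarrow> 'v"
    and br :: "'v \<Rightarrow> 'v \<Rightarrow> 'v"
  assumes "simple_lie_algebra scale br"
    and "(2::'k) \<noteq> 0" and "(3::'k) \<noteq> 0"
  shows "(\<exists>\<phi>. comm_2_cocycle scale br \<phi> \<and> (\<exists>x y. \<phi> x y \<noteq> 0)) \<longleftrightarrow> satisfies_s5 scale br"
proof -
  have lie: "lie_algebra scale br"
    using assms(1) by (simp add: simple_lie_algebra_def)
  interpret lie_bracket scale br
    unfolding lie_bracket_def lie_bracket_axioms_def using lie by (simp add: lie_algebra_def)
  interpret simple_lie_bracket scale br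
  proof
    show "\<exists>x y. br x y \<noteq> 0"
      using assms(1) by (simp add: simple_lie_algebra_def)
    show "I = {0} \<or> I = UNIV" if "subspace I" "\<And>x y. y \<in> I \<Longrightarrow> br x y \<in> I" for I
      using assms(1) that unfolding simple_lie_algebra_def lie_ideal_def by blast
  qed
  have s5_iff: "satisfies_s5 scale br \<longleftrightarrow> (\<forall>y a b c d. s5 y a b c d = 0)"
  proof
    assume "satisfies_s5 scale br"
    then have s5: "s5 y (x 1) (x 2) (x 3) (x 4) = 0" for x :: "nat \<Rightarrow> 'v" and y
      unfolding satisfies_s5_def s5_eq_sum_permutations by blast
    show "\<forall>y a b c d. s5 y a b c d = 0"
    proof (intro allI)
      fix y a b c d
      show "s5 y a b c d = 0"
        using s5[of y "\<lambda>i. if i = 1 then a else if i = 2 then b else if i = 3 then c else d"] by simp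
    qed
  qed (unfold satisfies_s5_def s5_eq_sum_permutations, blast)
  show ?thesis
  proof
    assume "\<exists>\<phi>. comm_2_cocycle scale br \<phi> \<and> (\<exists>x y. \<phi> x y \<noteq> 0)"
    then show "satisfies_s5 scale br"
      unfolding s5_iff using s5_if_cocycle[OF assms(2,3)] by blast
  next
    assume "satisfies_s5 scale br"
    then have s5: "s5 y a b c d = 0" for y a b c d
      by (simp add: s5_iff)
    show "\<exists>\<phi>. comm_2_cocycle scale br \<phi> \<and> (\<exists>x y. \<phi> x y \<noteq> 0)"
    proof (cases "\<forall>a b c u v. wr a b c (br u v) = br u (wr a b c v)")
      case True
      then have "centroidal (wr a b c)" for a b c
        by (simp add: centroidal_def Vector_Spaces.linear_iff vector_space_axioms)
      then show ?thesis
        using cocycle_if_wr_centroidal[OF assms(2)] by blast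
    next
      case False
      then show ?thesis
        using cocycle_if_wr_not_centroidal[OF s5] by blast
    qed
  qed
qed

end
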